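(* Let $R$ be a commutative noetherian ring, let $\mathfrak{a}$ be an ideal of $R$, and let $\mathcal{S}$ be a subcategory of $R$-Mod which is closed under taking submodules. If $\mathcal{S}$ satisfies the $C_{\sqrt{\mathfrak{a}}}$ condition, then $\mathcal{S}$ satisfies the $C_{\mathfrak{a}}$ condition. Moreover, if $\mathcal{S}$ is a Serre subcategory, then the converse holds too: if $\mathcal{S}$ satisfies the $C_{\mathfrak{a}}$ condition, then it satisfies the $C_{\sqrt{\mathfrak{a}}}$ condition.
   Context: $R$-Mod is the category of $R$-modules; all subcategories are full (identified with their classes of objects). A subcategory is Serre if it is closed under taking submodules, quotients and extensions. For an ideal $\mathfrak{a}$ and an $R$-module $M$, $\Gamma_{\mathfrak{a}}(M)=\{m\in M : \mathfrak{a}^k m=0 \text{ for some } k\ge 1\}$ and $(0:_M\mathfrak{a})=\{m\in M:\mathfrak{a}m=0\}$. A class $\mathcal{S}$ of $R$-modules satisfies the $C_{\mathfrak{a}}$ condition if for every $R$-module $M$: $\Gamma_{\mathfrak{a}}(M)=M$ and $(0:_M\mathfrak{a})\in\mathcal{S}$ imply $M\in\mathcal{S}$. *)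

theory Defs
  imports "HOL-Algebra.Module" "HOL-Algebra.Ideal_Product" "HOL-Algebra.Ring_Divisibility"
begin

definition ideal_radical :: "('a, 'r) ring_scheme \<Rightarrow> 'a set \<Rightarrow> 'a set"
  where "ideal_radical R \<aa> = {r \<in> carrier R. \<exists>n::nat. n \<ge> 1 \<and> r [^]\<^bsub>R\<^esub> n \<in> \<aa>}"

(* The power of an ideal is taken in the monoid of ideals of R under the ideal product. *)
definition torsion_part ::
    "('a, 'r) ring_scheme \<Rightarrow> 'a set \<Rightarrow> ('a, 'b, 'm) module_scheme \<Rightarrow> 'b set"
  where "torsion_part R \<aa> M =
    {m \<in> carrier M. \<exists>k::nat. k \<ge> 1 \<and>
       (\<forall>x \<in> \<aa> [^]\<^bsub>ideals_set R\<^esub> k. x \<odot>\<^bsub>M\<^esub> m = \<zero>\<^bsub>M\<^esub>)}"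

definition annihilated_part :: "'a set \<Rightarrow> ('a, 'b, 'm) module_scheme \<Rightarrow> 'b set"
  where "annihilated_part \<aa> M = {m \<in> carrier M. \<forall>x \<in> \<aa>. x \<odot>\<^bsub>M\<^esub> m = \<zero>\<^bsub>M\<^esub>}"

definition module_hom ::
    "('a, 'r) ring_scheme \<Rightarrow> ('a, 'b, 'm) module_scheme \<Rightarrow> ('a, 'c, 'n) module_scheme
      \<Rightarrow> ('b \<Rightarrow> 'c) set"
  where "module_hom R M N =
    {f \<in> hom (add_monoid M) (add_monoid N).
       \<forall>r \<in> carrier R. \<forall>x \<in> carrier M. f (r \<odot>\<^bsub>M\<^esub> x) = r \<odot>\<^bsub>N\<^esub> f x}"

definition short_exact ::
    "('a, 'r) ring_scheme \<Rightarrow> ('a, 'b, 'm) module_scheme \<Rightarrow> ('b \<Rightarrow> 'c)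
      \<Rightarrow> ('a, 'c, 'n) module_scheme \<Rightarrow> ('c \<Rightarrow> 'd) \<Rightarrow> ('a, 'd, 'o) module_scheme \<Rightarrow> bool"
  where "short_exact R N f M g L \<longleftrightarrow>
    module R N \<and> module R M \<and> module R L \<and>
    f \<in> module_hom R N M \<and> g \<in> module_hom R M L \<and>
    inj_on f (carrier N) \<and> g ` carrier M = carrier L \<and>
    f ` carrier N = {x \<in> carrier M. g x = \<zero>\<^bsub>L\<^esub>}"

(* HOL has no class of all sets to draw carriers from, so R-Mod is represented by the
   R-modules whose carrier is a set of elements of a type 'b. That type is arbitrary, and a
   full subcategory is given by its objects. *)
definition Mod_subcategory :: "('a, 'r) ring_scheme \<Rightarrow> ('a, 'b) module set \<Rightarrow> bool"
  where "Mod_subcategory R \<S> \<longleftrightarrow> (\<forall>M \<in> \<S>. module R M)"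

definition closed_under_submodules :: "('a, 'r) ring_scheme \<Rightarrow> ('a, 'b) module set \<Rightarrow> bool"
  where "closed_under_submodules R \<S> \<longleftrightarrow>
    (\<forall>M \<in> \<S>. \<forall>N. submodule N R M \<longrightarrow> M\<lparr>carrier := N\<rparr> \<in> \<S>)"

(* The cosets forming M/N do not live in the carrier type of M, so quotients are taken up to
   isomorphism: they are the targets of the surjective homomorphisms from M. In particular a
   class closed under quotients is closed under isomorphism. *)
definition closed_under_quotients :: "('a, 'r) ring_scheme \<Rightarrow> ('a, 'b) module set \<Rightarrow> bool"
  where "closed_under_quotients R \<S> \<longleftrightarrow>
    (\<forall>M \<in> \<S>. \<forall>L g. module R L \<and> g \<in> module_hom R M L \<and> g ` carrier M = carrier L
       \<longrightarrow> L \<in> \<S>)"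

definition closed_under_extensions :: "('a, 'r) ring_scheme \<Rightarrow> ('a, 'b) module set \<Rightarrow> bool"
  where "closed_under_extensions R \<S> \<longleftrightarrow>
    (\<forall>N \<in> \<S>. \<forall>L \<in> \<S>. \<forall>M f g. short_exact R N f M g L \<longrightarrow> M \<in> \<S>)"

definition Serre_subcategory :: "('a, 'r) ring_scheme \<Rightarrow> ('a, 'b) module set \<Rightarrow> bool"
  where "Serre_subcategory R \<S> \<longleftrightarrow>
    Mod_subcategory R \<S> \<and> closed_under_submodules R \<S> \<and>
    closed_under_quotients R \<S> \<and> closed_under_extensions R \<S>"

definition C_condition :: "('a, 'r) ring_scheme \<Rightarrow> 'a set \<Rightarrow> ('a, 'b) module set \<Rightarrow> bool"
  where "C_condition R \<aa> \<S> \<longleftrightarrow>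
    (\<forall>M. module R M \<and> torsion_part R \<aa> M = carrier M \<and>
         M\<lparr>carrier := annihilated_part \<aa> M\<rparr> \<in> \<S> \<longrightarrow> M \<in> \<S>)"

end

theory Submission
  imports Defs
begin

text \<open>
  Write \<open>\<rr>\<close> for the radical of \<open>\<aa>\<close>. Since \<open>R\<close> is noetherian, some power of \<open>\<rr>\<close> lies in \<open>\<aa>\<close>
  (\<open>genideal_power_subset\<close>), so an element killed by a power of \<open>\<aa>\<close> is killed by a power of
  \<open>\<rr>\<close> and \<open>\<Gamma>\<close> is the same for both ideals (\<open>torsion_part_ideal_radical\<close>). The two conditions
  therefore differ only in whether \<open>(0 :\<^sub>M \<aa>)\<close> or \<open>(0 :\<^sub>M \<rr>)\<close> is required to lie in \<open>\<S>\<close>.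

  As \<open>(0 :\<^sub>M \<rr>)\<close> is a submodule of \<open>(0 :\<^sub>M \<aa>)\<close>, closure under submodules gives the first
  implication. For the converse, \<open>(0 :\<^sub>M \<aa>)\<close> has to be built from \<open>(0 :\<^sub>M \<rr>)\<close>. Let \<open>x\<^sub>1, \<dots>, x\<^sub>t\<close>
  generate \<open>\<rr>\<close>; each \<open>x\<^sub>i\<close> acts nilpotently on \<open>N = (0 :\<^sub>M \<aa>)\<close>, and the part of \<open>N\<close> killed by
  all of them is \<open>(0 :\<^sub>M \<rr>)\<close>. The generators are treated one at a time: if \<open>x\<close> acts nilpotently
  on a module and the kernel of \<open>x\<close> is in \<open>\<S>\<close>, then so is the module
  (\<open>in_class_if_power_annihilates\<close>), because multiplication by \<open>x\<close> maps the kernel of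
  \<open>x\<^bsup>j+1\<^esup>\<close> onto a submodule of the kernel of \<open>x\<^bsup>j\<^esup>\<close>, with kernel that of \<open>x\<close>.
\<close>

section \<open>Radicals of ideals in noetherian rings\<close>

locale noetherian_cring = noetherian_ring + cring

lemma (in cring) ideal_power_simps:
  assumes "ideal I R"
  shows "I [^]\<^bsub>ideals_set R\<^esub> (1::nat) = I"
    and "I [^]\<^bsub>ideals_set R\<^esub> (Suc k) = (I [^]\<^bsub>ideals_set R\<^esub> k) \<cdot> I"
    and "I [^]\<^bsub>ideals_set R\<^esub> (k + l) = (I [^]\<^bsub>ideals_set R\<^esub> k) \<cdot> (I [^]\<^bsub>ideals_set R\<^esub> l)"
    and "ideal (I [^]\<^bsub>ideals_set R\<^esub> k) R"
proof -
  interpret ideals: comm_monoid "ideals_set R"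
    by (rule ideals_set_is_comm_monoid)
  have I: "I \<in> carrier (ideals_set R)"
    using assms by (simp add: ideals_set_def)
  have mult: "(\<otimes>\<^bsub>ideals_set R\<^esub>) = ideal_prod R"
    by (simp add: ideals_set_def)
  show "I [^]\<^bsub>ideals_set R\<^esub> (1::nat) = I"
    using I by simp
  show "I [^]\<^bsub>ideals_set R\<^esub> (Suc k) = (I [^]\<^bsub>ideals_set R\<^esub> k) \<cdot> I"
    by (simp add: mult)
  show "I [^]\<^bsub>ideals_set R\<^esub> (k + l) = (I [^]\<^bsub>ideals_set R\<^esub> k) \<cdot> (I [^]\<^bsub>ideals_set R\<^esub> l)"
    using ideals.nat_pow_mult[OF I, of k l] by (simp add: mult)
  show "ideal (I [^]\<^bsub>ideals_set R\<^esub> k) R"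
    using ideals.nat_pow_closed[OF I, of k] by (simp add: ideals_set_def)
qed

lemma ideal_prod_mono:
  assumes "I \<subseteq> I'" and "J \<subseteq> J'"
  shows "ideal_prod R I J \<subseteq> ideal_prod R I' J'"
proof
  fix s assume "s \<in> ideal_prod R I J"
  then show "s \<in> ideal_prod R I' J'"
    using assms by induct (auto intro: ideal_prod.intros)
qed

lemma (in cring) ideal_power_mono:
  assumes "ideal I R" and "ideal J R" and "I \<subseteq> J"
  shows "I [^]\<^bsub>ideals_set R\<^esub> (k::nat) \<subseteq> J [^]\<^bsub>ideals_set R\<^esub> k"
proof (induct k)
  case 0
  then show ?case by (simp add: ideals_set_def)
next
  case (Suc k)
  then show ?case
    unfolding ideal_power_simps(2)[OF assms(1)] ideal_power_simps(2)[OF assms(2)]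
    by (rule ideal_prod_mono[OF _ assms(3)])
qed

lemma (in cring) power_in_ideal_power:
  assumes "ideal I R" and "x \<in> I"
  shows "x [^] (k::nat) \<in> I [^]\<^bsub>ideals_set R\<^esub> k"
proof (induct k)
  case 0
  then show ?case by (simp add: ideals_set_def)
next
  case (Suc k)
  then show ?case
    using assms by (simp add: ideal_power_simps ideal_prod.prod del: Group.nat_pow_Suc)
qed

lemma (in primeideal) power_in_imp_in:
  assumes "x \<in> carrier R" and "x [^] (n::nat) \<in> I"
  shows "x \<in> I"
  using assms(2)
proof (induct n)
  case 0
  then have "I = carrier R"
    using one_imp_carrier by simp
  then show ?case using I_notcarr by simp
next
  case (Suc n)
  then show ?case
    using I_prime[of "x [^] n" x] assms(1) by auto
qed

lemma (in cring) ideal_prod_adjoin_subset: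
  assumes P: "ideal P R" and x: "x \<in> carrier R" and y: "y \<in> carrier R" and xy: "x \<otimes> y \<in> P"
  shows "(P <+>\<^bsub>R\<^esub> PIdl x) \<cdot> (P <+>\<^bsub>R\<^esub> PIdl y) \<subseteq> P"
proof
  interpret P: ideal P R by fact
  fix s assume "s \<in> (P <+>\<^bsub>R\<^esub> PIdl x) \<cdot> (P <+>\<^bsub>R\<^esub> PIdl y)"
  then show "s \<in> P"
  proof induct
    case (prod i j)
    from prod obtain p u where i: "p \<in> P" "u \<in> carrier R" "i = p \<oplus> u \<otimes> x"
      by (auto simp: set_add_def' cgenideal_def)
    from prod obtain q v where j: "q \<in> P" "v \<in> carrier R" "j = q \<oplus> v \<otimes> y"
      by (auto simp: set_add_def' cgenideal_def)
    have carr: "p \<in> carrier R" "q \<in> carrier R"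
      using i j P.Icarr by auto
    have "i \<otimes> j = p \<otimes> j \<oplus> ((u \<otimes> x) \<otimes> q \<oplus> (u \<otimes> v) \<otimes> (x \<otimes> y))"
      using i(2) j(2) x y carr unfolding i(3) j(3) by algebra
    moreover have "\<dots> \<in> P"
    proof (intro P.a_closed)
      show "p \<otimes> j \<in> P"
        using i j y carr by (intro P.I_r_closed) auto
      show "(u \<otimes> x) \<otimes> q \<in> P"
        using i j x by (intro P.I_l_closed) auto
      show "(u \<otimes> v) \<otimes> (x \<otimes> y) \<in> P"
        using P.I_l_closed[OF xy] i j by simp
    qed
    ultimately show ?case by simp
  next
    case (sum s1 s2)
    then show ?case by simp
  qed
qed

text \<open>
  If the claim fails, the ascending chain condition provides an ideal that is maximal among those
  containing \<open>I\<close> but no power of \<open>Idl X\<close>. It is prime: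
  adjoining either factor of a product in it gives an ideal containing a power of \<open>Idl X\<close>, and
  the product of the two enlarged ideals is contained in the original one. But a prime ideal
  containing \<open>I\<close> contains \<open>X\<close>, hence \<open>Idl X\<close>. The lemma speaks of a generating set because it
  serves to show that the radical is an ideal in the first place.
\<close>

lemma (in noetherian_cring) genideal_power_subset:
  assumes I: "ideal I R" and X: "X \<subseteq> ideal_radical R I"
  shows "\<exists>k::nat. k \<ge> 1 \<and> (Idl X) [^]\<^bsub>ideals_set R\<^esub> k \<subseteq> I"
proof (rule ccontr)
  define b where "b = Idl X"
  define bad where
    "bad = {J. ideal J R \<and> I \<subseteq> J \<and> (\<forall>k::nat. k \<ge> 1 \<longrightarrow> \<not> b [^]\<^bsub>ideals_set R\<^esub> k \<subseteq> J)}"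
  have X_carr: "X \<subseteq> carrier R"
    using X by (auto simp: ideal_radical_def)
  have b: "ideal b R"
    unfolding b_def using X_carr by (rule genideal_ideal)
  assume "\<not> ?thesis"
  with I have "I \<in> bad"
    by (auto simp: bad_def b_def)
  then have "bad \<noteq> {}" by blast
  then have "\<exists>P\<in>bad. \<forall>J\<in>bad. P \<subseteq> J \<longrightarrow> J = P"
  proof (rule subset_Zorn_nonempty)
    fix C assume C: "C \<noteq> {}" "subset.chain bad C"
    then have "subset.chain {J. ideal J R} C"
      unfolding pred_on.chain_def bad_def by blast
    with C have "\<Union>C \<in> C"
      using ideal_chain_is_trivial by blast
    with C show "\<Union>C \<in> bad"
      unfolding pred_on.chain_def by blast
  qed
  then obtain P where P_bad: "P \<in> bad" and P_max: "\<And>J. J \<in> bad \<Longrightarrow> P \<subseteq> J \<Longrightarrow> J = P"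
    by blast
  then have P: "ideal P R" and IP: "I \<subseteq> P"
    and not_in_P: "\<And>k::nat. k \<ge> 1 \<Longrightarrow> \<not> b [^]\<^bsub>ideals_set R\<^esub> k \<subseteq> P"
    by (auto simp: bad_def)
  interpret P: ideal P R by (rule P)
  have adjoin: "\<exists>k::nat. k \<ge> 1 \<and> b [^]\<^bsub>ideals_set R\<^esub> k \<subseteq> P <+>\<^bsub>R\<^esub> PIdl x"
    if x: "x \<in> carrier R" "x \<notin> P" for x
  proof -
    have *: "ideal (P <+>\<^bsub>R\<^esub> PIdl x) R" "P \<union> PIdl x \<subseteq> P <+>\<^bsub>R\<^esub> PIdl x"
      using P cgenideal_ideal[OF x(1)] union_genideal[of P "PIdl x"] add_ideals
        genideal_self[of "P \<union> PIdl x"] P.a_subset ideal.Icarr[OF cgenideal_ideal[OF x(1)]]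
      by blast+
    then have "P <+>\<^bsub>R\<^esub> PIdl x \<noteq> P"
      using cgenideal_self[OF x(1)] x(2) by blast
    with * P_max have "P <+>\<^bsub>R\<^esub> PIdl x \<notin> bad" by blast
    with * IP show ?thesis by (auto simp: bad_def)
  qed
  have "primeideal P R"
  proof (rule primeidealI)
    show "carrier R \<noteq> P"
      using not_in_P[of 1] ideal_power_simps(1)[OF b] additive_subgroup.a_subset[OF ideal.axioms(1)[OF b]]
      by auto
    fix x y assume x: "x \<in> carrier R" and y: "y \<in> carrier R" and xy: "x \<otimes> y \<in> P"
    show "x \<in> P \<or> y \<in> P"
    proof (rule ccontr)
      assume "\<not> (x \<in> P \<or> y \<in> P)"
      then obtain k l :: nat where kl: "k \<ge> 1" "l \<ge> 1"
        "b [^]\<^bsub>ideals_set R\<^esub> k \<subseteq> P <+>\<^bsub>R\<^esub> PIdl x" "b [^]\<^bsub>ideals_set R\<^esub> l \<subseteq> P <+>\<^bsub>R\<^esub> PIdl y"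
        using adjoin x y by meson
      then have "b [^]\<^bsub>ideals_set R\<^esub> (k + l) \<subseteq> P"
        unfolding ideal_power_simps(3)[OF b]
        by (intro subset_trans[OF ideal_prod_mono[OF kl(3,4)] ideal_prod_adjoin_subset[OF P x y xy]])
      then show False
        using not_in_P[of "k + l"] kl by simp
    qed
  qed (use P is_cring in auto)
  then interpret P: primeideal P R .
  have "X \<subseteq> P"
  proof
    fix x assume "x \<in> X"
    then obtain n :: nat where "x \<in> carrier R" "x [^] n \<in> I"
      using X by (auto simp: ideal_radical_def)
    then show "x \<in> P"
      using IP P.power_in_imp_in by blast
  qed
  then have "b \<subseteq> P"
    unfolding b_def by (rule genideal_minimal[OF P])
  then show False
    using not_in_P[of 1] ideal_power_simps(1)[OF b] by simp
qed

text \<open>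
  Some power of the generated ideal lies in \<open>I\<close>, so each of its elements has a power in \<open>I\<close>.
  This replaces the binomial expansion of a power of a sum.
\<close>

lemma (in noetherian_cring) Idl_ideal_radical:
  assumes "ideal I R"
  shows "Idl (ideal_radical R I) = ideal_radical R I"
proof
  have carr: "ideal_radical R I \<subseteq> carrier R"
    by (auto simp: ideal_radical_def)
  note J = genideal_ideal[OF carr]
  show "ideal_radical R I \<subseteq> Idl (ideal_radical R I)"
    by (rule genideal_self[OF carr])
  obtain k :: nat where k: "k \<ge> 1" "(Idl (ideal_radical R I)) [^]\<^bsub>ideals_set R\<^esub> k \<subseteq> I"
    using genideal_power_subset[OF assms order_refl] by blast
  show "Idl (ideal_radical R I) \<subseteq> ideal_radical R I"
  proof
    fix x assume x: "x \<in> Idl (ideal_radical R I)"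
    then have "x [^] k \<in> I"
      using power_in_ideal_power[OF J] k by blast
    with k x show "x \<in> ideal_radical R I"
      using ideal.Icarr[OF J] by (auto simp: ideal_radical_def)
  qed
qed

lemma (in noetherian_cring) ideal_radical_ideal:
  assumes "ideal I R"
  shows "ideal (ideal_radical R I) R"
proof -
  have "ideal (Idl (ideal_radical R I)) R"
    by (rule genideal_ideal) (auto simp: ideal_radical_def)
  then show ?thesis
    by (simp add: Idl_ideal_radical[OF assms])
qed

lemma (in cring) subset_ideal_radical:
  assumes "ideal I R"
  shows "I \<subseteq> ideal_radical R I"
proof
  fix x assume "x \<in> I"
  then have "x \<in> carrier R" "x [^] (1::nat) \<in> I"
    using ideal.Icarr[OF assms] by auto
  then show "x \<in> ideal_radical R I"
    unfolding ideal_radical_def by blast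
qed

section \<open>Annihilators\<close>

lemma (in module) smult_left_commute:
  assumes "r \<in> carrier R" and "s \<in> carrier R" and "m \<in> carrier M"
  shows "r \<odot>\<^bsub>M\<^esub> (s \<odot>\<^bsub>M\<^esub> m) = s \<odot>\<^bsub>M\<^esub> (r \<odot>\<^bsub>M\<^esub> m)"
  using assms R.m_comm[of r s] by (metis smult_assoc1)

lemma (in module) annihilator_ideal:
  assumes "X \<subseteq> carrier M"
  shows "ideal {r \<in> carrier R. \<forall>m \<in> X. r \<odot>\<^bsub>M\<^esub> m = \<zero>\<^bsub>M\<^esub>} R"
proof (rule idealI)
  show "ring R" by (rule R.ring_axioms)
  show "subgroup {r \<in> carrier R. \<forall>m \<in> X. r \<odot>\<^bsub>M\<^esub> m = \<zero>\<^bsub>M\<^esub>} (add_monoid R)"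
    using assms
    by (intro subgroup.intro)
      (auto simp: smult_l_distr subset_iff smult_l_minus simp flip: a_inv_def)
next
  fix r s assume "r \<in> {r \<in> carrier R. \<forall>m \<in> X. r \<odot>\<^bsub>M\<^esub> m = \<zero>\<^bsub>M\<^esub>}" and s: "s \<in> carrier R"
  then have r: "r \<in> carrier R" "\<And>m. m \<in> X \<Longrightarrow> r \<odot>\<^bsub>M\<^esub> m = \<zero>\<^bsub>M\<^esub>" by auto
  show *: "s \<otimes> r \<in> {r \<in> carrier R. \<forall>m \<in> X. r \<odot>\<^bsub>M\<^esub> m = \<zero>\<^bsub>M\<^esub>}"
    using r s assms by (auto simp: smult_assoc1 subset_iff)
  then show "r \<otimes> s \<in> {r \<in> carrier R. \<forall>m \<in> X. r \<odot>\<^bsub>M\<^esub> m = \<zero>\<^bsub>M\<^esub>}"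
    using r s by (simp add: R.m_comm)
qed

lemma (in module) annihilated_part_submodule:
  assumes "A \<subseteq> carrier R"
  shows "submodule (annihilated_part A M) R M"
proof (rule submoduleI)
  fix a x assume a: "a \<in> carrier R" and x: "x \<in> annihilated_part A M"
  have "r \<odot>\<^bsub>M\<^esub> (a \<odot>\<^bsub>M\<^esub> x) = \<zero>\<^bsub>M\<^esub>" if "r \<in> A" for r
  proof -
    have "r \<odot>\<^bsub>M\<^esub> (a \<odot>\<^bsub>M\<^esub> x) = a \<odot>\<^bsub>M\<^esub> (r \<odot>\<^bsub>M\<^esub> x)"
      using that assms a x
      by (intro smult_left_commute) (auto simp: annihilated_part_def)
    then show ?thesis
      using that a x by (simp add: annihilated_part_def)
  qed
  then show "a \<odot>\<^bsub>M\<^esub> x \<in> annihilated_part A M"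
    using a x by (simp add: annihilated_part_def)
qed (use assms in \<open>auto simp: annihilated_part_def smult_r_distr smult_r_minus subset_iff\<close>)

lemma (in module) annihilated_part_Idl:
  assumes "A \<subseteq> carrier R"
  shows "annihilated_part (Idl A) M = annihilated_part A M"
proof
  show "annihilated_part (Idl A) M \<subseteq> annihilated_part A M"
    using R.genideal_self[OF assms] by (auto simp: annihilated_part_def)
  let ?ann = "{r \<in> carrier R. \<forall>m \<in> annihilated_part A M. r \<odot>\<^bsub>M\<^esub> m = \<zero>\<^bsub>M\<^esub>}"
  have "ideal ?ann R"
    by (rule annihilator_ideal) (auto simp: annihilated_part_def)
  then have "Idl A \<subseteq> ?ann"
    by (rule R.genideal_minimal) (use assms in \<open>auto simp: annihilated_part_def\<close>)
  then show "annihilated_part A M \<subseteq> annihilated_part (Idl A) M"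
    by (auto simp: annihilated_part_def)
qed

text \<open>
  Being a submodule of \<open>K\<close> rather than of \<open>M\<close> refers to the additive inverses computed in \<open>K\<close>;
  that these agree with those of \<open>M\<close> is settled by comparing the module structures instead.
\<close>

lemma submodule_restrict:
  assumes M: "module R M" and H: "submodule H R M" and K: "submodule K R M" and HK: "H \<subseteq> K"
  shows "submodule H R (M\<lparr>carrier := K\<rparr>)"
  using module.module_incl_imp_submodule[OF submodule.submodule_is_module[OF K M], of H]
    submodule.submodule_is_module[OF H M] HK
  by simp

lemma closed_under_submodules_restrict:
  assumes S: "closed_under_submodules R \<S>" and M: "module R M"
    and H: "submodule H R M" and K: "submodule K R M" and HK: "H \<subseteq> K"
    and KS: "M\<lparr>carrier := K\<rparr> \<in> \<S>"
  shows "M\<lparr>carrier := H\<rparr> \<in> \<S>"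
  using S KS submodule_restrict[OF M H K HK] unfolding closed_under_submodules_def by force

section \<open>Torsion\<close>

lemma (in cring) torsion_part_antimono:
  assumes "ideal I R" and "ideal J R" and "I \<subseteq> J"
  shows "torsion_part R J M \<subseteq> torsion_part R I M"
  using ideal_power_mono[OF assms] unfolding torsion_part_def by blast

lemma (in noetherian_cring) torsion_part_ideal_radical:
  assumes M: "module R M" and I: "ideal I R"
  shows "torsion_part R (ideal_radical R I) M = torsion_part R I M"
proof
  note J = ideal_radical_ideal[OF I]
  show "torsion_part R (ideal_radical R I) M \<subseteq> torsion_part R I M"
    by (rule torsion_part_antimono[OF I J subset_ideal_radical[OF I]])
  obtain k :: nat where k: "k \<ge> 1" "(ideal_radical R I) [^]\<^bsub>ideals_set R\<^esub> k \<subseteq> I"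
    using genideal_power_subset[OF I order_refl] Idl_ideal_radical[OF I] by auto
  interpret ideals: comm_monoid "ideals_set R"
    by (rule ideals_set_is_comm_monoid)
  have powers: "(ideal_radical R I) [^]\<^bsub>ideals_set R\<^esub> (k * l) \<subseteq> I [^]\<^bsub>ideals_set R\<^esub> l" for l :: nat
  proof -
    have "(ideal_radical R I) [^]\<^bsub>ideals_set R\<^esub> (k * l)
        = ((ideal_radical R I) [^]\<^bsub>ideals_set R\<^esub> k) [^]\<^bsub>ideals_set R\<^esub> l"
      using J by (intro ideals.nat_pow_pow[symmetric]) (simp add: ideals_set_def)
    also have "\<dots> \<subseteq> I [^]\<^bsub>ideals_set R\<^esub> l"
      using k by (intro ideal_power_mono ideal_power_simps(4) I J)
    finally show ?thesis .
  qed
  show "torsion_part R I M \<subseteq> torsion_part R (ideal_radical R I) M"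
  proof
    fix m assume "m \<in> torsion_part R I M"
    then obtain l :: nat where "m \<in> carrier M" "l \<ge> 1"
      "\<forall>x \<in> I [^]\<^bsub>ideals_set R\<^esub> l. x \<odot>\<^bsub>M\<^esub> m = \<zero>\<^bsub>M\<^esub>"
      unfolding torsion_part_def by blast
    moreover have "k * l \<ge> 1"
      using k \<open>l \<ge> 1\<close> by simp
    ultimately show "m \<in> torsion_part R (ideal_radical R I) M"
      using powers[of l] unfolding torsion_part_def by blast
  qed
qed

section \<open>Classes closed under submodules and extensions\<close>

lemma (in module) smult_image_submodule:
  assumes x: "x \<in> carrier R" and H: "submodule H R M"
  shows "submodule ((\<lambda>m. x \<odot>\<^bsub>M\<^esub> m) ` H) R M"
proof (rule submoduleI)
  note HM = submoduleE(1)[OF H, THEN subsetD]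
  show "(\<lambda>m. x \<odot>\<^bsub>M\<^esub> m) ` H \<subseteq> carrier M"
    using x HM by auto
  show "\<zero>\<^bsub>M\<^esub> \<in> (\<lambda>m. x \<odot>\<^bsub>M\<^esub> m) ` H"
    using x subgroup.one_closed[OF submodule.axioms(1)[OF H]] by (force simp: image_iff)
  show "\<ominus>\<^bsub>M\<^esub> a \<in> (\<lambda>m. x \<odot>\<^bsub>M\<^esub> m) ` H" if "a \<in> (\<lambda>m. x \<odot>\<^bsub>M\<^esub> m) ` H" for a
    using that x HM submoduleE(3)[OF H] by (auto simp flip: smult_r_minus)
  show "a \<oplus>\<^bsub>M\<^esub> b \<in> (\<lambda>m. x \<odot>\<^bsub>M\<^esub> m) ` H"
    if "a \<in> (\<lambda>m. x \<odot>\<^bsub>M\<^esub> m) ` H" "b \<in> (\<lambda>m. x \<odot>\<^bsub>M\<^esub> m) ` H" for a b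
    using that x HM submoduleE(5)[OF H] by (auto simp flip: smult_r_distr)
  show "r \<odot>\<^bsub>M\<^esub> a \<in> (\<lambda>m. x \<odot>\<^bsub>M\<^esub> m) ` H"
    if r: "r \<in> carrier R" and "a \<in> (\<lambda>m. x \<odot>\<^bsub>M\<^esub> m) ` H" for r a
  proof -
    from that obtain m where m: "m \<in> H" "a = x \<odot>\<^bsub>M\<^esub> m" by blast
    then have "r \<odot>\<^bsub>M\<^esub> a = x \<odot>\<^bsub>M\<^esub> (r \<odot>\<^bsub>M\<^esub> m)"
      using x r HM smult_left_commute by simp
    then show ?thesis
      using m r submoduleE(4)[OF H] by blast
  qed
qed

text \<open>
  The three terms of this sequence are submodules of the same module, which keeps the whole
  induction inside one carrier type: no coset and no direct sum is formed, because
  \<open>H / (0 :\<^sub>M x)\<close> is replaced by its isomorphic image \<open>x H\<close>.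
\<close>

lemma short_exact_smult:
  assumes M: "module R M" and x: "x \<in> carrier R" and H: "submodule H R M"
    and ann_subset: "annihilated_part {x} M \<subseteq> H"
  shows "short_exact R (M\<lparr>carrier := annihilated_part {x} M\<rparr>) id (M\<lparr>carrier := H\<rparr>)
    (\<lambda>m. x \<odot>\<^bsub>M\<^esub> m) (M\<lparr>carrier := (\<lambda>m. x \<odot>\<^bsub>M\<^esub> m) ` H\<rparr>)"
proof -
  interpret module R M by fact
  note HM = submoduleE(1)[OF H, THEN subsetD]
  have K: "submodule (annihilated_part {x} M) R M"
    using x by (intro annihilated_part_submodule) simp
  have lin: "x \<odot>\<^bsub>M\<^esub> (r \<odot>\<^bsub>M\<^esub> m) = r \<odot>\<^bsub>M\<^esub> (x \<odot>\<^bsub>M\<^esub> m)" if "r \<in> carrier R" "m \<in> H" for r m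
    using x that HM by (intro smult_left_commute) auto
  have add: "x \<odot>\<^bsub>M\<^esub> (m \<oplus>\<^bsub>M\<^esub> n) = x \<odot>\<^bsub>M\<^esub> m \<oplus>\<^bsub>M\<^esub> x \<odot>\<^bsub>M\<^esub> n" if "m \<in> H" "n \<in> H" for m n
    using x that HM by (simp add: smult_r_distr)
  show ?thesis
    unfolding short_exact_def
    using submodule.submodule_is_module[OF H M] submodule.submodule_is_module[OF K M]
      submodule.submodule_is_module[OF smult_image_submodule[OF x H] M] HM ann_subset
    by (auto simp: module_hom_def hom_def lin add annihilated_part_def)
qed

text \<open>
  Induction along the filtration of \<open>M\<close> by the kernels of the powers of \<open>x\<close>, which reaches \<open>M\<close>
  after \<open>n\<close> steps.
\<close>

lemma in_class_if_power_annihilates: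
  fixes M :: "('a, 'b) module"
  assumes sub: "closed_under_submodules R \<S>" and ext: "closed_under_extensions R \<S>"
    and M: "module R M" and x: "x \<in> carrier R"
    and nil: "\<And>m. m \<in> carrier M \<Longrightarrow> x [^]\<^bsub>R\<^esub> (n::nat) \<odot>\<^bsub>M\<^esub> m = \<zero>\<^bsub>M\<^esub>"
    and ann: "M\<lparr>carrier := annihilated_part {x} M\<rparr> \<in> \<S>"
  shows "M \<in> \<S>"
proof -
  interpret module R M by fact
  let ?H = "\<lambda>j::nat. annihilated_part {x [^]\<^bsub>R\<^esub> j} M"
  have H: "submodule (?H j) R M" for j
    using x by (intro annihilated_part_submodule) simp
  have K: "submodule (annihilated_part {x} M) R M"
    using x by (intro annihilated_part_submodule) simp
  have K_sub: "annihilated_part {x} M \<subseteq> ?H (Suc j)" for j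
    using x by (auto simp: annihilated_part_def smult_assoc1)
  have "M\<lparr>carrier := ?H j\<rparr> \<in> \<S>" for j
  proof (induct j)
    case 0
    have "?H 0 \<subseteq> annihilated_part {x} M"
      using x by (auto simp: annihilated_part_def)
    then show ?case
      by (rule closed_under_submodules_restrict[OF sub M H K _ ann])
  next
    case (Suc j)
    let ?L = "(\<lambda>m. x \<odot>\<^bsub>M\<^esub> m) ` ?H (Suc j)"
    have L: "submodule ?L R M"
      by (rule smult_image_submodule[OF x H])
    have "?L \<subseteq> ?H j"
      using x by (auto simp: annihilated_part_def smult_assoc1)
    then have "M\<lparr>carrier := ?L\<rparr> \<in> \<S>"
      by (rule closed_under_submodules_restrict[OF sub M L H _ Suc])
    then show ?case
      using ext ann short_exact_smult[OF M x H K_sub] unfolding closed_under_extensions_def by blast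
  qed
  from this[of n] have "M\<lparr>carrier := ?H n\<rparr> \<in> \<S>" .
  moreover have "?H n = carrier M"
    using nil by (auto simp: annihilated_part_def)
  ultimately show ?thesis by simp
qed

text \<open>
  The kernel of \<open>x\<close> is again a module on which the elements of \<open>F\<close> act nilpotently, and its part
  annihilated by \<open>F\<close> is the part of \<open>M\<close> annihilated by \<open>insert x F\<close>; so the induction has to
  range over all modules.
\<close>

lemma in_class_if_powers_annihilate:
  fixes M :: "('a, 'b) module"
  assumes sub: "closed_under_submodules R \<S>" and ext: "closed_under_extensions R \<S>"
    and M: "module R M" and "finite F" and "F \<subseteq> carrier R"
    and nil: "\<And>x. x \<in> F \<Longrightarrow> \<exists>n::nat. \<forall>m \<in> carrier M. x [^]\<^bsub>R\<^esub> n \<odot>\<^bsub>M\<^esub> m = \<zero>\<^bsub>M\<^esub>"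
    and ann: "M\<lparr>carrier := annihilated_part F M\<rparr> \<in> \<S>"
  shows "M \<in> \<S>"
  using \<open>finite F\<close> \<open>F \<subseteq> carrier R\<close> M nil ann
proof (induct F arbitrary: M)
  case empty
  then show ?case by (simp add: annihilated_part_def)
next
  case (insert x F)
  let ?H = "annihilated_part {x} M"
  let ?N = "M\<lparr>carrier := ?H\<rparr>"
  interpret module R M by (rule insert.prems)
  have x: "x \<in> carrier R" using insert.prems by simp
  have H: "submodule ?H R M"
    using x by (intro annihilated_part_submodule) simp
  have "annihilated_part F ?N = annihilated_part (insert x F) M"
    by (auto simp: annihilated_part_def)
  then have "?N\<lparr>carrier := annihilated_part F ?N\<rparr> \<in> \<S>"
    using insert.prems(4) by simp
  moreover have nil_N: "\<exists>n::nat. \<forall>m \<in> carrier ?N. y [^]\<^bsub>R\<^esub> n \<odot>\<^bsub>?N\<^esub> m = \<zero>\<^bsub>?N\<^esub>" if "y \<in> F" for y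
    using insert.prems(3)[of y] that by (auto simp: annihilated_part_def)
  ultimately have "?N \<in> \<S>"
    using insert.prems(1) submodule.submodule_is_module[OF H insert.prems(2)]
    by (intro insert.hyps(3)[of ?N] nil_N) blast+
  moreover obtain n :: nat where "\<forall>m \<in> carrier M. x [^]\<^bsub>R\<^esub> n \<odot>\<^bsub>M\<^esub> m = \<zero>\<^bsub>M\<^esub>"
    using insert.prems(3) by blast
  ultimately show ?case
    using in_class_if_power_annihilates[OF sub ext insert.prems(2) x] by blast
qed

lemma (in noetherian_cring) annihilated_part_in_class:
  fixes M :: "('a, 'c) module"
  assumes sub: "closed_under_submodules R \<S>" and ext: "closed_under_extensions R \<S>"
    and M: "module R M" and I: "ideal I R"
    and ann: "M\<lparr>carrier := annihilated_part (ideal_radical R I) M\<rparr> \<in> \<S>"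
  shows "M\<lparr>carrier := annihilated_part I M\<rparr> \<in> \<S>"
proof -
  interpret M: module R M by fact
  let ?N = "M\<lparr>carrier := annihilated_part I M\<rparr>"
  have sub_I: "submodule (annihilated_part I M) R M"
    using ideal.Icarr[OF I] by (intro M.annihilated_part_submodule) blast
  then have N: "module R ?N"
    using M by (rule submodule.submodule_is_module)
  obtain F where F: "F \<subseteq> carrier R" "finite F" "ideal_radical R I = Idl F"
    using finetely_gen[OF ideal_radical_ideal[OF I]] by blast
  have "annihilated_part F M \<subseteq> annihilated_part I M"
    using subset_ideal_radical[OF I] M.annihilated_part_Idl[OF F(1)] F(3)
    by (auto simp: annihilated_part_def)
  then have "annihilated_part F ?N = annihilated_part (ideal_radical R I) M"
    using M.annihilated_part_Idl[OF F(1)] F(3) by (auto simp: annihilated_part_def)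
  with ann have ann_F: "?N\<lparr>carrier := annihilated_part F ?N\<rparr> \<in> \<S>"
    by simp
  have "\<exists>n::nat. \<forall>m \<in> carrier ?N. x [^] n \<odot>\<^bsub>?N\<^esub> m = \<zero>\<^bsub>?N\<^esub>" if "x \<in> F" for x
  proof -
    have "x \<in> ideal_radical R I"
      using that F genideal_self by blast
    then show ?thesis
      by (auto simp: ideal_radical_def annihilated_part_def)
  qed
  then show ?thesis
    by (rule in_class_if_powers_annihilate[OF sub ext N F(2,1) _ ann_F])
qed

section \<open>The two torsion conditions\<close>

theorem proposition2p5:
  fixes R :: "('a, 'r) ring_scheme"
    and \<aa> :: "'a set"
    and \<S> :: "('a, 'b) module set"
  assumes "cring R" and "noetherian_ring R"
    and "ideal \<aa> R"
    and "Mod_subcategory R \<S>"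
    and "closed_under_submodules R \<S>"
  shows "(C_condition R (ideal_radical R \<aa>) \<S> \<longrightarrow> C_condition R \<aa> \<S>) \<and>
    (Serre_subcategory R \<S> \<longrightarrow>
      C_condition R \<aa> \<S> \<longrightarrow> C_condition R (ideal_radical R \<aa>) \<S>)"
proof (intro conjI impI)
  interpret noetherian_cring R
    using assms(1,2) by (intro noetherian_cring.intro)
  note I = \<open>ideal \<aa> R\<close>
  note torsion = torsion_part_ideal_radical[OF _ I]
  {
    assume C: "C_condition R (ideal_radical R \<aa>) \<S>"
    show "C_condition R \<aa> \<S>"
      unfolding C_condition_def
    proof (intro allI impI)
      fix M :: "('a, 'b) module"
      assume "module R M \<and> torsion_part R \<aa> M = carrier M \<and>
        M\<lparr>carrier := annihilated_part \<aa> M\<rparr> \<in> \<S>"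
      then have M: "module R M" and tors: "torsion_part R \<aa> M = carrier M"
        and ann: "M\<lparr>carrier := annihilated_part \<aa> M\<rparr> \<in> \<S>"
        by auto
      have subs: "submodule (annihilated_part J M) R M" if "ideal J R" for J
        using ideal.Icarr[OF that] by (intro module.annihilated_part_submodule[OF M]) blast
      have "annihilated_part (ideal_radical R \<aa>) M \<subseteq> annihilated_part \<aa> M"
        using subset_ideal_radical[OF I] by (auto simp: annihilated_part_def)
      then have "M\<lparr>carrier := annihilated_part (ideal_radical R \<aa>) M\<rparr> \<in> \<S>"
        by (rule closed_under_submodules_restrict[OF assms(5) M subs[OF ideal_radical_ideal[OF I]] subs[OF I] _ ann])
      then show "M \<in> \<S>"
        using C M tors torsion[OF M] unfolding C_condition_def by blast
    qed
  next
    assume "Serre_subcategory R \<S>" and C: "C_condition R \<aa> \<S>"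
    then have ext: "closed_under_extensions R \<S>"
      by (simp add: Serre_subcategory_def)
    show "C_condition R (ideal_radical R \<aa>) \<S>"
      unfolding C_condition_def
    proof (intro allI impI)
      fix M :: "('a, 'b) module"
      assume M: "module R M \<and> torsion_part R (ideal_radical R \<aa>) M = carrier M \<and>
        M\<lparr>carrier := annihilated_part (ideal_radical R \<aa>) M\<rparr> \<in> \<S>"
      then have "M\<lparr>carrier := annihilated_part \<aa> M\<rparr> \<in> \<S>"
        using annihilated_part_in_class[OF assms(5) ext _ I] by blast
      then show "M \<in> \<S>"
        using C M torsion[of M] unfolding C_condition_def by blast
    qed
  }
qed

end
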